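(* Let $1\le p<\infty$, let $\mathbb{E}[|A_1|^p]<\infty$, and let $\lambda$ be a continuous periodic intensity function on $\mathbb{R}^d$ satisfying $0<\lambda_{\min}:=\inf_t\lambda(t)\le\|\lambda\|_\infty<\infty$. Let $Y(dt)=\sum_{j\ge1}A_j\delta_{t_j}(dt)$ be the corresponding inhomogeneous, compound Poisson point process. Let $\gamma_k=(s_k,\xi_k)$ be a sequence of scale and frequency pairs ($s_k>0$, $\xi_k\in\mathbb{R}^d$) such that $\lim_{k\to\infty}s_k=0$. Then $$\lim_{k\to\infty}\frac{S_{\gamma_k,p}Y(t)}{s_k^d}=\lambda(t)\,\mathbb{E}[|A_1|^p]\,\|w\|_p^p\quad\text{for all }t\in\mathbb{R}^d,$$ and consequently $$\lim_{k\to\infty}\frac{SY(\gamma_k,p)}{s_k^d}=m_1(\lambda)\,\mathbb{E}[|A_1|^p]\,\|w\|_p^p.$$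
   Context: Window and filters: $w\in L^2(\mathbb{R}^d)$ is a continuous function with support contained in $[0,1]^d$. For $\gamma=(s,\xi)$ with $s>0$, $\xi\in\mathbb{R}^d$, set $g_\gamma(t)=w(t/s)e^{i\xi\cdot t}$, $t\in\mathbb{R}^d$. $\|w\|_p$ is the $L^p(\mathbb{R}^d)$ norm. Process: $\lambda$ is periodic with period $T>0$ along each coordinate, and $m_1(\lambda)=\frac1{T^d}\int_{[0,T]^d}\lambda(t)\,dt$. $\Lambda(B)=\int_B\lambda(u)\,du$ for Borel $B\subset\mathbb{R}^d$. $N(dt)=\sum_{j=1}^\infty\delta_{t_j}(dt)$ is an inhomogeneous Poisson point process with intensity $\lambda$: for Borel sets $B$, $P(N(B)=n)=e^{-\Lambda(B)}\Lambda(B)^n/n!$, and $N(B)$ is independent of $N(B')$ for all $B'$ that do not intersect $B$. $(A_j)_{j\ge1}$ is a sequence of i.i.d. random variables (charges) independent of $N$. $Y(dt)=\sum_{j=1}^\infty A_j\delta_{t_j}(dt)$. Scattering moments: for a function $f$, $(f*Y)(t)=\int_{\mathbb{R}^d}f(t-u)\,Y(du)=\sum_jA_jf(t-t_j)$; $S_{\gamma,p}Y(t)=\mathbb{E}[|(g_\gamma*Y)(t)|^p]$; and the time-invariant moment is $SY(\gamma,p)=\frac1{T^d}\int_{[0,T]^d}S_{\gamma,p}Y(t)\,dt$. *)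

theory Defs
  imports "HOL-Probability.Probability"
begin

definition Lp_norm :: "real \<Rightarrow> (real ^ 'd \<Rightarrow> complex) \<Rightarrow> real" where
  "Lp_norm p f = (\<integral>t. norm (f t) powr p \<partial>lborel) powr (1 / p)"

definition gabor_filter :: "(real ^ 'd \<Rightarrow> complex) \<Rightarrow> real \<times> (real ^ 'd) \<Rightarrow> real ^ 'd \<Rightarrow> complex" where
  "gabor_filter w \<gamma> t =
     (case \<gamma> of (s, \<xi>) \<Rightarrow> w (t /\<^sub>R s) * exp (\<i> * complex_of_real (\<xi> \<bullet> t)))"

definition cube :: "real \<Rightarrow> (real ^ 'd) set" where
  "cube T = {t. \<forall>i. 0 \<le> t $ i \<and> t $ i \<le> T}"

definition coord_periodic :: "real \<Rightarrow> (real ^ 'd \<Rightarrow> real) \<Rightarrow> bool" where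
  "coord_periodic T f \<longleftrightarrow> (\<forall>i t. f (t + T *\<^sub>R axis i 1) = f t)"

definition cube_mean :: "real \<Rightarrow> (real ^ 'd \<Rightarrow> real) \<Rightarrow> real" where
  "cube_mean T f = 1 / T ^ CARD('d) * (LINT t:cube T|lborel. f t)"

definition intensity_measure :: "(real ^ 'd \<Rightarrow> real) \<Rightarrow> (real ^ 'd) measure" where
  "intensity_measure lam = density lborel (\<lambda>u. ennreal (lam u))"

text \<open>The random measure \<open>N = (\<Sum>j. \<delta>\<^bsub>x j\<^esub>)\<close> evaluated at the set \<open>B\<close>; the value may be infinite.\<close>

definition point_count :: "(nat \<Rightarrow> 'w \<Rightarrow> real ^ 'd) \<Rightarrow> (real ^ 'd) set \<Rightarrow> 'w \<Rightarrow> ennreal" where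
  "point_count x B \<omega> = (\<Sum>j. indicator B (x j \<omega>))"

text \<open>The points are indexed by all natural numbers, so the definition presupposes infinite total
  intensity. Sets of infinite intensity need no separate clause: that their counts are almost surely
  infinite follows by exhausting them with sets of finite intensity.\<close>

locale poisson_point_process = prob_space M
  for M :: "'w measure" +
  fixes lam :: "real ^ 'd \<Rightarrow> real"
    and x :: "nat \<Rightarrow> 'w \<Rightarrow> real ^ 'd"
  assumes intensity_measurable: "lam \<in> borel_measurable borel"
    and intensity_nonneg: "0 \<le> lam u"
    and points_measurable: "x j \<in> borel_measurable M"
    and poisson_counts:
      "B \<in> sets borel \<Longrightarrow> emeasure (intensity_measure lam) B < \<infinity> \<Longrightarrow>
         prob {\<omega> \<in> space M. point_count x B \<omega> = of_nat n} =
           exp (- measure (intensity_measure lam) B)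
             * measure (intensity_measure lam) B ^ n / fact n"
    and indep_counts:
      "B \<in> sets borel \<Longrightarrow> B' \<in> sets borel \<Longrightarrow> B \<inter> B' = {} \<Longrightarrow>
         indep_var borel (point_count x B) borel (point_count x B')"

text \<open>The charges are required to be independent of the enumerated points, not just of the counts.
  Otherwise the enumeration could depend on the charges, and the charge attached to a point
  would in general not be distributed like \<open>A 0\<close>. It is stated through the generated
  sigma-algebras because \<open>indep_var\<close> needs both variables to have the same range type.\<close>

locale compound_poisson_process = poisson_point_process M lam x
  for M :: "'w measure" and lam :: "real ^ 'd \<Rightarrow> real" and x :: "nat \<Rightarrow> 'w \<Rightarrow> real ^ 'd" +
  fixes A :: "nat \<Rightarrow> 'w \<Rightarrow> real"
  assumes charges_indep: "indep_vars (\<lambda>_. borel) A UNIV"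
    and charges_identically_distributed: "distr M borel (A j) = distr M borel (A 0)"
    and charges_indep_points:
      "indep_set (sets (vimage_algebra (space M) (\<lambda>\<omega> j. A j \<omega>) (Pi\<^sub>M UNIV (\<lambda>_. borel))))
                 (sets (vimage_algebra (space M) (\<lambda>\<omega> j. x j \<omega>) (Pi\<^sub>M UNIV (\<lambda>_. borel))))"

text \<open>\<open>f * Y\<close> for \<open>Y = (\<Sum>j. A j \<cdot> \<delta>\<^bsub>x j\<^esub>)\<close>. For \<open>f\<close> of bounded support and locally bounded
  intensity, almost surely only finitely many terms are nonzero.\<close>

definition process_conv ::
  "(real ^ 'd \<Rightarrow> complex) \<Rightarrow> (nat \<Rightarrow> 'w \<Rightarrow> real ^ 'd) \<Rightarrow> (nat \<Rightarrow> 'w \<Rightarrow> real)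
    \<Rightarrow> real ^ 'd \<Rightarrow> 'w \<Rightarrow> complex" where
  "process_conv f x A t \<omega> = (\<Sum>j. complex_of_real (A j \<omega>) * f (t - x j \<omega>))"

definition scattering_moment ::
  "'w measure \<Rightarrow> (nat \<Rightarrow> 'w \<Rightarrow> real ^ 'd) \<Rightarrow> (nat \<Rightarrow> 'w \<Rightarrow> real) \<Rightarrow> (real ^ 'd \<Rightarrow> complex)
    \<Rightarrow> real \<times> (real ^ 'd) \<Rightarrow> real \<Rightarrow> real ^ 'd \<Rightarrow> real" where
  "scattering_moment M x A w \<gamma> p t =
     (\<integral>\<omega>. norm (process_conv (gabor_filter w \<gamma>) x A t \<omega>) powr p \<partial>M)"

definition invariant_scattering_moment ::
  "real \<Rightarrow> 'w measure \<Rightarrow> (nat \<Rightarrow> 'w \<Rightarrow> real ^ 'd) \<Rightarrow> (nat \<Rightarrow> 'w \<Rightarrow> real)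
    \<Rightarrow> (real ^ 'd \<Rightarrow> complex) \<Rightarrow> real \<times> (real ^ 'd) \<Rightarrow> real \<Rightarrow> real" where
  "invariant_scattering_moment T M x A w \<gamma> p = cube_mean T (scattering_moment M x A w \<gamma> p)"

end

theory Submission
  imports Defs
begin

text \<open>Let \<open>B\<close> be the set of points seen by the filter at \<open>t\<close>, \<open>N\<close> its count and \<open>m\<close> its intensity,
  which is at most a constant times \<open>s ^ d\<close>. If \<open>N \<le> 1\<close>, then the \<open>p\<close>-th power of the modulus of
  \<open>\<Sum>j. A j * g (t - x j)\<close> equals \<open>\<Sum>j. \<bar>A j\<bar> powr p * norm (g (t - x j)) powr p\<close>; otherwise the two
  differ by at most \<open>N ^ q\<close>, \<open>q \<ge> p\<close> an integer, times \<open>\<Sum>j. \<bar>A j\<bar> powr p * indicator B (x j)\<close>, up to a constant. Since the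
  charges are independent of the points, the mean of the sum of powers is given by Campbell's
  formula, and the mean of the error is at most a multiple of the moment of order \<open>q + 1\<close> of \<open>N\<close> on
  \<open>{N \<ge> 2}\<close>, hence of \<open>m\<^sup>2\<close>. Dividing by \<open>s ^ d\<close> and substituting \<open>u = t - s *\<^sub>R v\<close> leaves an error
  of order \<open>s ^ d\<close>, uniformly in \<open>t\<close>, and an integral that converges by dominated convergence.\<close>

section \<open>Product formula for independent sigma-algebras, and a bound on powers\<close>

text \<open>\<open>U\<close> and \<open>V\<close> generate sub-sigma-algebras of \<open>F\<close>
  and \<open>G\<close>, so they are independent variables; their joint law is a product measure and
  Tonelli splits the integral. Working with nonnegative extended values allows infinite
  expectations, so integrability need not be checked in advance.\<close>

lemma (in prob_space) indep_set_nn_integral_mult: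
  fixes U V :: "'a \<Rightarrow> ennreal"
  assumes ind: "indep_set (sets F) (sets G)"
    and sp: "space F = space M" "space G = space M"
    and U: "U \<in> borel_measurable F" and V: "V \<in> borel_measurable G"
  shows "(\<integral>\<^sup>+\<omega>. U \<omega> * V \<omega> \<partial>M) = (\<integral>\<^sup>+\<omega>. U \<omega> \<partial>M) * (\<integral>\<^sup>+\<omega>. V \<omega> \<partial>M)"
proof -
  have UM[measurable]: "U \<in> borel_measurable M"
    using U indep_setD_ev1[OF ind] sp by (auto simp: measurable_def)
  have VM[measurable]: "V \<in> borel_measurable M"
    using V indep_setD_ev2[OF ind] sp by (auto simp: measurable_def)
  have subU: "sigma_sets (space M) {U -` A \<inter> space M |A. A \<in> sets borel} \<subseteq> sets F"
    using U sp(1) by (intro sets.sigma_sets_subset[of _ F, unfolded sp]) (auto simp: measurable_def)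
  have subV: "sigma_sets (space M) {V -` A \<inter> space M |A. A \<in> sets borel} \<subseteq> sets G"
    using V sp(2) by (intro sets.sigma_sets_subset[of _ G, unfolded sp]) (auto simp: measurable_def)
  have iv: "indep_var borel U borel V"
    unfolding indep_var_eq
  proof (intro conjI UM VM)
    show "indep_set (sigma_sets (space M) {U -` A \<inter> space M |A. A \<in> sets borel})
        (sigma_sets (space M) {V -` A \<inter> space M |A. A \<in> sets borel})"
      using ind unfolding indep_set_def
    proof (rule indep_sets_mono_sets)
      fix i show "(case i of True \<Rightarrow> sigma_sets (space M) {U -` A \<inter> space M |A. A \<in> sets borel}
          | False \<Rightarrow> sigma_sets (space M) {V -` A \<inter> space M |A. A \<in> sets borel})
        \<subseteq> (case i of True \<Rightarrow> sets F | False \<Rightarrow> sets G)"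
        using subU subV by (cases i) (simp_all only: bool.case)
    qed
  qed
  interpret D: prob_space "distr M borel V" by (rule prob_space_distr) fact
  have "(\<integral>\<^sup>+\<omega>. U \<omega> * V \<omega> \<partial>M)
      = (\<integral>\<^sup>+z. fst z * snd z \<partial>distr M (borel \<Otimes>\<^sub>M borel) (\<lambda>\<omega>. (U \<omega>, V \<omega>)))"
    by (subst nn_integral_distr) auto
  also have "\<dots> = (\<integral>\<^sup>+z. fst z * snd z \<partial>(distr M borel U \<Otimes>\<^sub>M distr M borel V))"
    using iv unfolding indep_var_distribution_eq by simp
  also have "\<dots> = (\<integral>\<^sup>+u. \<integral>\<^sup>+v. u * v \<partial>distr M borel V \<partial>distr M borel U)"
    by (subst D.nn_integral_fst[symmetric]) auto
  also have "\<dots> = (\<integral>\<^sup>+\<omega>. U \<omega> \<partial>M) * (\<integral>\<^sup>+\<omega>. V \<omega> \<partial>M)"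
    by (simp add: nn_integral_cmult nn_integral_multc nn_integral_distr)
  finally show ?thesis .
qed

text \<open>One term of the exponential series is at most its sum. This trades a power of the count
  for a factor \<open>exp n\<close>, which the Poisson weights absorb.\<close>

lemma nat_power_le_fact_exp: "real n ^ k \<le> fact k * exp (real n)"
proof -
  have "real n ^ k / fact k = (\<Sum>i\<in>{k}. real n ^ i / fact i)" by simp
  also have "\<dots> \<le> (\<Sum>i. real n ^ i / fact i)"
    using summable_exp[of "real n"] by (intro sum_le_suminf) (auto simp: field_simps)
  also have "\<dots> = exp (real n)"
    by (simp add: exp_def divide_inverse mult.commute)
  finally show ?thesis by (simp add: field_simps)
qed

section \<open>Counts and Campbell's formula\<close>

context poisson_point_process
begin

declare points_measurable [measurable]

lemma intensity_measurable_ennreal [measurable]: "(\<lambda>u. ennreal (lam u)) \<in> borel_measurable borel"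
  using intensity_measurable by measurable

lemma sets_intensity_measure [measurable_cong, simp]: "sets (intensity_measure lam) = sets borel"
  by (simp add: intensity_measure_def)

lemma point_count_measurable [measurable]:
  assumes [measurable]: "B \<in> sets borel"
  shows "point_count x B \<in> borel_measurable M"
  unfolding point_count_def by measurable

text \<open>The Poisson weights add up to one, so the disjoint events \<open>E n\<close> exhaust the
  space up to a null set and the value infinity is excluded.\<close>

lemma AE_point_count_finite:
  assumes B: "B \<in> sets borel" and fin: "emeasure (intensity_measure lam) B < \<infinity>"
  shows "AE \<omega> in M. point_count x B \<omega> \<in> range of_nat"
proof -
  define m where "m = measure (intensity_measure lam) B"
  define E where "E n = {\<omega> \<in> space M. point_count x B \<omega> = of_nat n}" for n :: nat
  note [measurable] = B
  have [measurable]: "E n \<in> sets M" for n unfolding E_def by measurable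
  have "(\<lambda>n. m ^ n /\<^sub>R fact n) sums exp m" by (rule exp_converges)
  from sums_mult[OF this, of "exp (- m)"]
  have 1: "(\<lambda>n. prob (E n)) sums 1"
    unfolding E_def poisson_counts[OF B fin] m_def[symmetric]
    by (simp add: exp_minus field_simps)
  have "(\<lambda>n. prob (E n)) sums prob (\<Union>n. E n)"
    by (intro finite_measure_UNION) (auto simp: disjoint_family_on_def E_def)
  with 1 have "prob (\<Union>n. E n) = 1" by (metis sums_unique2)
  then have "AE \<omega> in M. \<omega> \<in> (\<Union>n. E n)" by (intro AE_prob_1)
  then show ?thesis by eventually_elim (auto simp: E_def)
qed

text \<open>Almost surely the integrand is a countable combination of indicators of the level sets
  of the count, which is why an arbitrary \<open>\<psi>\<close> is admissible.\<close>

lemma nn_integral_point_count: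
  fixes \<psi> :: "ennreal \<Rightarrow> ennreal"
  assumes B: "B \<in> sets borel" and fin: "emeasure (intensity_measure lam) B < \<infinity>"
  defines "m \<equiv> measure (intensity_measure lam) B"
  shows "(\<integral>\<^sup>+\<omega>. \<psi> (point_count x B \<omega>) \<partial>M)
    = (\<Sum>n. \<psi> (of_nat n) * ennreal (exp (- m) * m ^ n / fact n))"
proof -
  note [measurable] = B
  define E where "E n = {\<omega> \<in> space M. point_count x B \<omega> = of_nat n}" for n :: nat
  have [measurable]: "E n \<in> sets M" for n unfolding E_def by measurable
  have "AE \<omega> in M. \<psi> (point_count x B \<omega>) = (\<Sum>n. \<psi> (of_nat n) * indicator (E n) \<omega>)"
    using AE_point_count_finite[OF B fin] AE_space
  proof eventually_elim
    case (elim \<omega>)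
    then obtain n where n: "point_count x B \<omega> = of_nat n" by auto
    have "(\<Sum>i. \<psi> (of_nat i) * indicator (E i) \<omega>) = (\<Sum>i\<in>{n}. \<psi> (of_nat i) * indicator (E i) \<omega>)"
      using n elim by (intro suminf_finite) (auto simp: E_def)
    then show ?case using n elim by (simp add: E_def)
  qed
  then have "(\<integral>\<^sup>+\<omega>. \<psi> (point_count x B \<omega>) \<partial>M)
      = (\<integral>\<^sup>+\<omega>. (\<Sum>n. \<psi> (of_nat n) * indicator (E n) \<omega>) \<partial>M)"
    by (rule nn_integral_cong_AE)
  also have "\<dots> = (\<Sum>n. \<psi> (of_nat n) * emeasure M (E n))"
    by (simp add: nn_integral_suminf nn_integral_cmult)
  also have "\<dots> = (\<Sum>n. \<psi> (of_nat n) * ennreal (exp (- m) * m ^ n / fact n))"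
    using poisson_counts[OF B fin] by (simp add: emeasure_eq_measure E_def m_def)
  finally show ?thesis .
qed

lemma nn_integral_point_count_mean:
  assumes B: "B \<in> sets borel" and fin: "emeasure (intensity_measure lam) B < \<infinity>"
  shows "(\<integral>\<^sup>+\<omega>. point_count x B \<omega> \<partial>M) = emeasure (intensity_measure lam) B"
proof -
  define m where "m = measure (intensity_measure lam) B"
  have m0: "0 \<le> m" by (simp add: m_def)
  have "(\<lambda>n. m ^ n /\<^sub>R fact n) sums exp m" by (rule exp_converges)
  from sums_mult[OF this, of "m * exp (- m)"]
  have "(\<lambda>n. real (Suc n) * (exp (- m) * m ^ Suc n / fact (Suc n))) sums m"
    by (simp add: exp_minus field_simps del: of_nat_Suc)
  then have s: "(\<lambda>n. real n * (exp (- m) * m ^ n / fact n)) sums m"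
    \<comment> \<open>The term at \<open>n = 0\<close> vanishes, so the shift of the index leaves
      the sum \<open>m\<close> unchanged.\<close>
    by (subst (asm) sums_Suc_iff) simp
  have "(\<integral>\<^sup>+\<omega>. point_count x B \<omega> \<partial>M) = (\<Sum>n. of_nat n * ennreal (exp (- m) * m ^ n / fact n))"
    using nn_integral_point_count[OF B fin, of "\<lambda>c. c"] by (simp add: m_def)
  also have "\<dots> = (\<Sum>n. ennreal (real n * (exp (- m) * m ^ n / fact n)))"
    using m0 by (intro suminf_cong) (simp only: ennreal_of_nat_eq_real_of_nat, subst ennreal_mult[symmetric], auto)
  also have "\<dots> = ennreal m"
    using s m0 by (intro sums_unique[symmetric]) (subst sums_ennreal, auto)
  also have "\<dots> = emeasure (intensity_measure lam) B"
    using fin by (simp add: m_def emeasure_eq_ennreal_measure less_top)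
  finally show ?thesis .
qed

text \<open>Truncation removes the terms \<open>n = 0\<close> and \<open>n = 1\<close>, so a factor
  \<open>m ^ 2\<close> can be taken out of every remaining Poisson weight. With
  \<open>n ^ k \<le> fact k * exp n\<close> the rest is dominated by the exponential series at
  \<open>exp 1 * L\<close>. The bound \<open>L\<close> is kept apart from \<open>m\<close> so that
  it can stay fixed while \<open>m\<close> tends to zero.\<close>

lemma nn_integral_point_count_tail:
  assumes B: "B \<in> sets borel" and fin: "emeasure (intensity_measure lam) B < \<infinity>"
    and L: "1 \<le> L" "measure (intensity_measure lam) B \<le> L"
  shows "(\<integral>\<^sup>+\<omega>. (if 2 \<le> point_count x B \<omega> then point_count x B \<omega> ^ k else 0) \<partial>M)
    \<le> ennreal ((measure (intensity_measure lam) B)\<^sup>2 * fact k * exp (exp 1 * L))"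
proof -
  define m where "m = measure (intensity_measure lam) B"
  have m0: "0 \<le> m" by (simp add: m_def)
  define \<psi> where "\<psi> c = (if 2 \<le> c then c ^ k else 0 :: ennreal)" for c
  have bound: "\<psi> (of_nat n) * ennreal (exp (- m) * m ^ n / fact n)
      \<le> ennreal (m\<^sup>2 * fact k * ((exp 1 * L) ^ n /\<^sub>R fact n))" for n
  proof (cases "n \<ge> 2")
    case True
    then have ge: "(2::ennreal) \<le> of_nat n"
      by (metis of_nat_le_iff of_nat_numeral)
    have "m ^ n = m\<^sup>2 * m ^ (n - 2)" using True by (metis le_add_diff_inverse power_add)
    also have "\<dots> \<le> m\<^sup>2 * L ^ (n - 2)"
      using m0 L(2) by (intro mult_left_mono power_mono) (auto simp: m_def)
    \<comment> \<open>The exponent goes back up from \<open>n - 2\<close> to \<open>n\<close> to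
      match \<open>fact n\<close>; this is where \<open>1 \<le> L\<close> enters.\<close>
    also have "\<dots> \<le> m\<^sup>2 * L ^ n"
      using L(1) by (intro mult_left_mono power_increasing) auto
    finally have mn: "m ^ n \<le> m\<^sup>2 * L ^ n" .
    have "real n ^ k * (exp (- m) * m ^ n / fact n)
        \<le> (fact k * exp (real n)) * (1 * (m\<^sup>2 * L ^ n) / fact n)"
      using m0 mn by (intro mult_mono nat_power_le_fact_exp divide_right_mono) auto
    also have "\<dots> = m\<^sup>2 * fact k * ((exp 1 * L) ^ n /\<^sub>R fact n)"
      by (simp add: power_mult_distrib exp_of_nat_mult[symmetric] divide_inverse mult_ac)
    finally have le: "ennreal (real n ^ k * (exp (- m) * m ^ n / fact n))
        \<le> ennreal (m\<^sup>2 * fact k * ((exp 1 * L) ^ n /\<^sub>R fact n))"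
      by (rule ennreal_leI)
    have "\<psi> (of_nat n) * ennreal (exp (- m) * m ^ n / fact n)
        = ennreal (real n ^ k) * ennreal (exp (- m) * m ^ n / fact n)"
      using ge by (simp add: \<psi>_def ennreal_of_nat_eq_real_of_nat ennreal_power)
    also have "\<dots> = ennreal (real n ^ k * (exp (- m) * m ^ n / fact n))"
      using m0 by (intro ennreal_mult[symmetric]) auto
    finally show ?thesis using le by simp
  next
    case False
    then have "n = 0 \<or> n = 1" by auto
    then show ?thesis by (auto simp: \<psi>_def)
  qed
  have "(\<integral>\<^sup>+\<omega>. \<psi> (point_count x B \<omega>) \<partial>M) = (\<Sum>n. \<psi> (of_nat n) * ennreal (exp (- m) * m ^ n / fact n))"
    using nn_integral_point_count[OF B fin, of \<psi>] by (simp add: m_def)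
  also have "\<dots> \<le> (\<Sum>n. ennreal (m\<^sup>2 * fact k * ((exp 1 * L) ^ n /\<^sub>R fact n)))"
    by (intro suminf_le bound) auto
  also have "\<dots> = ennreal (m\<^sup>2 * fact k * exp (exp 1 * L))"
    using L(1) sums_mult[OF exp_converges[of "exp 1 * L"], of "m\<^sup>2 * fact k"]
    by (intro sums_unique[symmetric]) (subst sums_ennreal, auto)
  finally show ?thesis by (simp add: \<psi>_def m_def)
qed

text \<open>The mean number of points in a Borel subset of \<open>B\<close> is its intensity, so the
  mean measure of the points and the intensity measure agree on \<open>B\<close>; hence so do their
  integrals of functions that vanish off \<open>B\<close>.\<close>

lemma nn_integral_campbell:
  fixes f :: "real ^ 'd \<Rightarrow> ennreal"
  assumes f[measurable]: "f \<in> borel_measurable borel"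
    and B[measurable]: "B \<in> sets borel" and fin: "emeasure (intensity_measure lam) B < \<infinity>"
    and supp: "\<And>u. u \<notin> B \<Longrightarrow> f u = 0"
  shows "(\<integral>\<^sup>+\<omega>. (\<Sum>j. f (x j \<omega>)) \<partial>M) = (\<integral>\<^sup>+u. f u \<partial>intensity_measure lam)"
proof -
  define X where "X z = x (fst z) (snd z)" for z
  \<comment> \<open>The mean measure of the points: the image of counting measure on the indices
    times the probability, so that integration against it is the mean of a sum over the
    points.\<close>
  define \<nu> where "\<nu> = distr (count_space UNIV \<Otimes>\<^sub>M M) borel X"
  have X[measurable]: "X \<in> borel_measurable (count_space UNIV \<Otimes>\<^sub>M M)"
    unfolding X_def by (rule measurable_compose_countable) auto
  have \<nu>: "(\<integral>\<^sup>+u. g u \<partial>\<nu>) = (\<integral>\<^sup>+\<omega>. (\<Sum>j. g (x j \<omega>)) \<partial>M)"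
    if [measurable]: "g \<in> borel_measurable borel" for g :: "real ^ 'd \<Rightarrow> ennreal"
  proof -
    have "(\<integral>\<^sup>+u. g u \<partial>\<nu>) = (\<integral>\<^sup>+z. g (X z) \<partial>(count_space UNIV \<Otimes>\<^sub>M M))"
      unfolding \<nu>_def by (intro nn_integral_distr) auto
    also have "\<dots> = (\<integral>\<^sup>+j. \<integral>\<^sup>+\<omega>. g (X (j, \<omega>)) \<partial>M \<partial>count_space UNIV)"
      by (intro nn_integral_fst[symmetric]) auto
    also have "\<dots> = (\<Sum>j. \<integral>\<^sup>+\<omega>. g (x j \<omega>) \<partial>M)"
      by (simp add: nn_integral_count_space_nat X_def)
    also have "\<dots> = (\<integral>\<^sup>+\<omega>. (\<Sum>j. g (x j \<omega>)) \<partial>M)"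
      by (intro nn_integral_suminf[symmetric]) auto
    finally show ?thesis .
  qed
  have [measurable_cong]: "sets \<nu> = sets borel" by (simp add: \<nu>_def)
  \<comment> \<open>Restriction to \<open>B\<close> leaves only sets \<open>B \<inter> C\<close> of
    finite intensity, for which the Poisson law is assumed.\<close>
  have eq: "density \<nu> (indicator B) = density (intensity_measure lam) (indicator B)"
  proof (rule measure_eqI)
    fix C assume "C \<in> sets (density \<nu> (indicator B))"
    then have C[measurable]: "C \<in> sets borel" by (simp add: \<nu>_def)
    have "emeasure (intensity_measure lam) (B \<inter> C) \<le> emeasure (intensity_measure lam) B"
      by (intro emeasure_mono) auto
    with fin have fin': "emeasure (intensity_measure lam) (B \<inter> C) < \<infinity>" by auto
    have "emeasure (density \<nu> (indicator B)) C = (\<integral>\<^sup>+u. indicator (B \<inter> C) u \<partial>\<nu>)"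
      by (simp add: emeasure_density indicator_inter_arith)
    also have "\<dots> = (\<integral>\<^sup>+\<omega>. point_count x (B \<inter> C) \<omega> \<partial>M)"
      by (subst \<nu>) (auto simp: point_count_def[abs_def])
    also have "\<dots> = emeasure (intensity_measure lam) (B \<inter> C)"
      by (intro nn_integral_point_count_mean fin') auto
    also have "\<dots> = emeasure (density (intensity_measure lam) (indicator B)) C"
      by (simp add: emeasure_density indicator_inter_arith[symmetric])
    finally show "emeasure (density \<nu> (indicator B)) C = emeasure (density (intensity_measure lam) (indicator B)) C" .
  qed (simp add: \<nu>_def)
  have fB: "indicator B u * f u = f u" for u
    using supp[of u] by (auto simp: indicator_def)
  have "(\<integral>\<^sup>+\<omega>. (\<Sum>j. f (x j \<omega>)) \<partial>M) = (\<integral>\<^sup>+u. f u \<partial>density \<nu> (indicator B))"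
    by (simp add: nn_integral_density fB \<nu>)
  also have "\<dots> = (\<integral>\<^sup>+u. f u \<partial>intensity_measure lam)"
    by (simp add: eq nn_integral_density fB)
  finally show ?thesis .
qed

end

section \<open>Independent charges\<close>

context compound_poisson_process
begin

lemma charge_measurable [measurable]: "A j \<in> borel_measurable M"
  using charges_indep by (auto simp: indep_vars_def)

lemma nn_integral_charge:
  assumes [measurable]: "g \<in> borel_measurable borel"
  shows "(\<integral>\<^sup>+\<omega>. g (A j \<omega>) \<partial>M) = (\<integral>\<^sup>+\<omega>. g (A 0 \<omega>) \<partial>M)"
proof -
  have "(\<integral>\<^sup>+\<omega>. g (A j \<omega>) \<partial>M) = (\<integral>\<^sup>+a. g a \<partial>distr M borel (A j))"
    by (simp add: nn_integral_distr)
  also have "\<dots> = (\<integral>\<^sup>+\<omega>. g (A 0 \<omega>) \<partial>M)"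
    unfolding charges_identically_distributed[of j] by (simp add: nn_integral_distr)
  finally show ?thesis .
qed

abbreviation "points_algebra \<equiv> vimage_algebra (space M) (\<lambda>\<omega> j. x j \<omega>) (Pi\<^sub>M UNIV (\<lambda>_. borel))"

lemma points_algebra_measurable: "x j \<in> borel_measurable points_algebra"
proof -
  have "(\<lambda>\<omega> j. x j \<omega>) \<in> measurable points_algebra (Pi\<^sub>M UNIV (\<lambda>_. borel))"
    by (rule measurable_vimage_algebra1) (auto simp: space_PiM)
  from measurable_compose[OF this measurable_component_singleton[of j]] show ?thesis by simp
qed

text \<open>Termwise, independence splits the mean, and identical distribution makes the charge
  factor common to all \<open>j\<close>. Each weight may depend on the whole sequence of points, so
  the random count may appear in it.\<close>

lemma nn_integral_charges_points:
  fixes g :: "real \<Rightarrow> ennreal" and V :: "nat \<Rightarrow> 'w \<Rightarrow> ennreal"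
  assumes g[measurable]: "g \<in> borel_measurable borel"
    and V: "\<And>j. V j \<in> borel_measurable points_algebra"
  shows "(\<integral>\<^sup>+\<omega>. (\<Sum>j. g (A j \<omega>) * V j \<omega>) \<partial>M)
    = (\<integral>\<^sup>+\<omega>. g (A 0 \<omega>) \<partial>M) * (\<integral>\<^sup>+\<omega>. (\<Sum>j. V j \<omega>) \<partial>M)"
proof -
  let ?F = "vimage_algebra (space M) (\<lambda>\<omega> j. A j \<omega>) (Pi\<^sub>M UNIV (\<lambda>_. borel))"
  have "(\<lambda>\<omega> j. A j \<omega>) \<in> measurable ?F (Pi\<^sub>M UNIV (\<lambda>_. borel))"
    by (rule measurable_vimage_algebra1) (auto simp: space_PiM)
  from measurable_compose[OF this measurable_component_singleton]
  have A: "A j \<in> borel_measurable ?F" for j by simp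
  have U: "(\<lambda>\<omega>. g (A j \<omega>)) \<in> borel_measurable ?F" for j
    using measurable_compose[OF A g] .
  have VM[measurable]: "V j \<in> borel_measurable M" for j
    using V[of j] indep_setD_ev2[OF charges_indep_points] by (auto simp: measurable_def)
  have "(\<integral>\<^sup>+\<omega>. (\<Sum>j. g (A j \<omega>) * V j \<omega>) \<partial>M) = (\<Sum>j. \<integral>\<^sup>+\<omega>. g (A j \<omega>) * V j \<omega> \<partial>M)"
    by (intro nn_integral_suminf) auto
  also have "\<dots> = (\<Sum>j. (\<integral>\<^sup>+\<omega>. g (A j \<omega>) \<partial>M) * (\<integral>\<^sup>+\<omega>. V j \<omega> \<partial>M))"
    using indep_set_nn_integral_mult[OF charges_indep_points _ _ U V] by simp
  also have "\<dots> = (\<integral>\<^sup>+\<omega>. g (A 0 \<omega>) \<partial>M) * (\<Sum>j. \<integral>\<^sup>+\<omega>. V j \<omega> \<partial>M)"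
    by (subst nn_integral_charge) auto
  also have "(\<Sum>j. \<integral>\<^sup>+\<omega>. V j \<omega> \<partial>M) = (\<integral>\<^sup>+\<omega>. (\<Sum>j. V j \<omega>) \<partial>M)"
    by (intro nn_integral_suminf[symmetric]) auto
  finally show ?thesis .
qed

end

section \<open>Moments of filtered processes\<close>

text \<open>With at most one summand the two quantities coincide. Otherwise the norm of the sum is
  at most \<open>card J\<close> times the largest norm, whose power is one of the terms of the sum
  of powers. An integer \<open>q\<close> is used so that the factor becomes a power of the count
  with a computable Poisson moment.\<close>

lemma norm_sum_powr_estimate:
  fixes z :: "'i \<Rightarrow> 'a::real_normed_vector"
  assumes J: "finite J" and p: "0 < p" "p \<le> real q"
  shows "\<bar>norm (\<Sum>j\<in>J. z j) powr p - (\<Sum>j\<in>J. norm (z j) powr p)\<bar>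
    \<le> (if 2 \<le> card J then real (card J) ^ q * (\<Sum>j\<in>J. norm (z j) powr p) else 0)"
proof (cases "2 \<le> card J")
  case False
  then consider "card J = 0" | "card J = 1" by linarith
  then show ?thesis
  proof cases
    case 1
    then show ?thesis using J p by auto
  next
    case 2
    then obtain a where "J = {a}" by (auto simp: card_1_singleton_iff)
    then show ?thesis by auto
  qed
next
  case True
  define n where "n = real (card J)"
  have n: "1 \<le> n" using True by (simp add: n_def)
  define S where "S = (\<Sum>j\<in>J. norm (z j) powr p)"
  have S0: "0 \<le> S" by (auto simp: S_def intro: sum_nonneg)
  have "J \<noteq> {}" using True by auto
  then have "Max ((\<lambda>j. norm (z j)) ` J) \<in> (\<lambda>j. norm (z j)) ` J"
    using J by (intro Max_in) auto
  then obtain a where a: "a \<in> J" "norm (z a) = Max ((\<lambda>j. norm (z j)) ` J)" by auto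
  have a_max: "norm (z j) \<le> norm (z a)" if "j \<in> J" for j
    unfolding a(2) using that J by (intro Max_ge) auto
  have "norm (\<Sum>j\<in>J. z j) \<le> (\<Sum>j\<in>J. norm (z a))"
    using a_max by (rule order_trans[OF norm_sum sum_mono])
  then have "norm (\<Sum>j\<in>J. z j) \<le> n * norm (z a)" by (simp add: n_def)
  then have "norm (\<Sum>j\<in>J. z j) powr p \<le> (n * norm (z a)) powr p"
    using p by (intro powr_mono2) auto
  also have "\<dots> = n powr p * norm (z a) powr p"
    using n by (simp add: powr_mult)
  also have "\<dots> \<le> n ^ q * S"
  proof (intro mult_mono)
    show "n powr p \<le> n ^ q"
      using n p(2) powr_mono[of p "real q" n] by (simp add: powr_realpow)
    show "norm (z a) powr p \<le> S"
      unfolding S_def using a(1) J by (intro member_le_sum) auto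
  qed (use n in auto)
  finally have 1: "norm (\<Sum>j\<in>J. z j) powr p \<le> n ^ q * S" .
  have 2: "S \<le> n ^ q * S"
    using n S0 by (simp add: mult_le_cancel_right1)
  \<comment> \<open>Both quantities lie between 0 and \<open>n ^ q * S\<close>, hence so does their
    distance.\<close>
  from 1 2 S0 have "\<bar>norm (\<Sum>j\<in>J. z j) powr p - S\<bar> \<le> n ^ q * S"
    using powr_ge_zero[of "norm (\<Sum>j\<in>J. z j)" p] by linarith
  then show ?thesis using True by (simp add: n_def S_def)
qed

text \<open>The count is the counting measure of the set of indices whose points lie in
  \<open>B\<close>, which is infinite for an infinite set.\<close>

lemma point_count_eq_of_nat:
  assumes "point_count x B \<omega> = of_nat n"
  shows "finite {j. x j \<omega> \<in> B}" "card {j. x j \<omega> \<in> B} = n"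
proof -
  let ?J = "{j. x j \<omega> \<in> B}"
  have "point_count x B \<omega> = (\<integral>\<^sup>+j. indicator ?J j \<partial>count_space UNIV)"
    unfolding nn_integral_count_space_nat point_count_def by (simp add: indicator_def[abs_def])
  also have "\<dots> = emeasure (count_space UNIV) ?J" by simp
  finally have e: "emeasure (count_space UNIV) ?J = of_nat n" using assms by simp
  show fin: "finite ?J"
  proof (rule ccontr)
    assume "infinite ?J"
    with e show False by simp
  qed
  show "card ?J = n" using e fin by simp
qed

text \<open>The pathwise comparison: \<open>D\<close> is the main term and \<open>E\<close> the
  error. Two one-sided inequalities replace an absolute difference, so that expectations can be
  taken before finiteness is known. In \<open>E\<close> the filter is replaced by its bound on
  \<open>B\<close>, so that the sum over \<open>j\<close> will give a power of the count
  alone.\<close>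

lemma process_conv_powr_estimate:
  fixes f :: "real ^ 'd \<Rightarrow> complex" and A :: "nat \<Rightarrow> 'w \<Rightarrow> real"
  assumes count: "point_count x B \<omega> = of_nat n"
    and p: "0 < p" "p \<le> real q"
    and supp: "\<And>u. u \<notin> B \<Longrightarrow> f (t - u) = 0" and bound: "\<And>u. norm (f (t - u)) \<le> W"
  defines "S \<equiv> ennreal (norm (process_conv f x A t \<omega>) powr p)"
    and "D \<equiv> \<Sum>j. ennreal (\<bar>A j \<omega>\<bar> powr p) * ennreal (norm (f (t - x j \<omega>)) powr p)"
    and "E \<equiv> \<Sum>j. ennreal (\<bar>A j \<omega>\<bar> powr p) *
      (ennreal (W powr p) * (if 2 \<le> point_count x B \<omega> then point_count x B \<omega> ^ q else 0)
        * indicator B (x j \<omega>))"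
  shows "S \<le> D + E" "D \<le> S + E"
proof -
  define J where "J = {j. x j \<omega> \<in> B}"
  have J: "finite J" "card J = n" using point_count_eq_of_nat[OF count] by (auto simp: J_def)
  define z where "z j = complex_of_real (A j \<omega>) * f (t - x j \<omega>)" for j
  define \<phi> where "\<phi> = (if 2 \<le> n then real n ^ q else 0)"
  have \<phi>0: "0 \<le> \<phi>" by (simp add: \<phi>_def)
  have two: "(2::ennreal) \<le> of_nat n \<longleftrightarrow> 2 \<le> n"
    by (metis of_nat_le_iff of_nat_numeral)
  have \<phi>: "(if 2 \<le> point_count x B \<omega> then point_count x B \<omega> ^ q else 0) = ennreal \<phi>"
    by (simp add: count two \<phi>_def ennreal_power ennreal_of_nat_eq_real_of_nat)
  have zp: "norm (z j) powr p = \<bar>A j \<omega>\<bar> powr p * norm (f (t - x j \<omega>)) powr p" for j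
    by (simp add: z_def norm_mult powr_mult)
  \<comment> \<open>Only indices in \<open>J\<close> contribute, so all three series reduce to
    finite sums.\<close>
  have S: "S = ennreal (norm (\<Sum>j\<in>J. z j) powr p)"
    unfolding S_def process_conv_def
    by (subst suminf_finite[of J]) (use J supp in \<open>auto simp: J_def z_def\<close>)
  have "D = (\<Sum>j. ennreal (norm (z j) powr p))"
    unfolding D_def by (simp add: zp ennreal_mult)
  also have "\<dots> = (\<Sum>j\<in>J. ennreal (norm (z j) powr p))"
    by (rule suminf_finite) (use J supp p in \<open>auto simp: J_def z_def\<close>)
  also have "\<dots> = ennreal (\<Sum>j\<in>J. norm (z j) powr p)"
    by simp
  finally have D: "D = ennreal (\<Sum>j\<in>J. norm (z j) powr p)" .
  have "E = (\<Sum>j\<in>J. ennreal (\<bar>A j \<omega>\<bar> powr p) * (ennreal (W powr p) * ennreal \<phi> * indicator B (x j \<omega>)))"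
    unfolding E_def \<phi> by (rule suminf_finite) (use J in \<open>auto simp: J_def\<close>)
  also have "\<dots> = (\<Sum>j\<in>J. ennreal (\<phi> * (\<bar>A j \<omega>\<bar> powr p * W powr p)))"
    using \<phi>0 by (intro sum.cong) (auto simp: J_def ennreal_mult mult_ac)
  also have "\<dots> = ennreal (\<phi> * (\<Sum>j\<in>J. \<bar>A j \<omega>\<bar> powr p * W powr p))"
    using \<phi>0 by (simp add: sum_distrib_left)
  finally have E: "E = ennreal (\<phi> * (\<Sum>j\<in>J. \<bar>A j \<omega>\<bar> powr p * W powr p))" .
  have "\<bar>norm (\<Sum>j\<in>J. z j) powr p - (\<Sum>j\<in>J. norm (z j) powr p)\<bar> \<le> \<phi> * (\<Sum>j\<in>J. norm (z j) powr p)"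
    using norm_sum_powr_estimate[OF J(1) p, of z] by (simp add: \<phi>_def J(2) split: if_splits)
  also have "\<dots> \<le> \<phi> * (\<Sum>j\<in>J. \<bar>A j \<omega>\<bar> powr p * W powr p)"
    unfolding zp using bound p by (intro mult_left_mono sum_mono powr_mono2 \<phi>0) auto
  finally have *: "\<bar>norm (\<Sum>j\<in>J. z j) powr p - (\<Sum>j\<in>J. norm (z j) powr p)\<bar>
      \<le> \<phi> * (\<Sum>j\<in>J. \<bar>A j \<omega>\<bar> powr p * W powr p)" .
  have nn: "0 \<le> \<phi> * (\<Sum>j\<in>J. \<bar>A j \<omega>\<bar> powr p * W powr p)"
    by (intro mult_nonneg_nonneg \<phi>0 sum_nonneg) auto
  have nn': "0 \<le> (\<Sum>j\<in>J. norm (z j) powr p)" by (auto intro: sum_nonneg)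
  show "S \<le> D + E"
    unfolding S D E using * nn nn' by (subst ennreal_plus[symmetric]) (auto intro!: ennreal_leI simp del: ennreal_plus)
  show "D \<le> S + E"
    unfolding S D E using * nn nn' by (subst ennreal_plus[symmetric]) (auto intro!: ennreal_leI simp del: ennreal_plus)
qed

text \<open>Finiteness of \<open>b\<close> passes to \<open>a\<close> through the first inequality,
  so both are genuine reals and the inequalities combine.\<close>

lemma abs_enn2real_diff_le:
  assumes "a \<le> b + ennreal e" "b \<le> a + ennreal e" "b < \<infinity>" "0 \<le> e"
  shows "\<bar>enn2real a - enn2real b\<bar> \<le> e"
proof -
  obtain b' where b: "0 \<le> b'" "b = ennreal b'" using assms(3) by (cases b) auto
  have "a < \<infinity>" using assms(1) b by (metis ennreal_less_top ennreal_plus assms(4) infinity_ennreal_def le_less_trans)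
  then obtain a' where a: "0 \<le> a'" "a = ennreal a'" by (cases a) auto
  show ?thesis using assms(1,2,4) a b
    by (auto simp: ennreal_plus[symmetric] simp del: ennreal_plus)
qed

context compound_poisson_process
begin

text \<open>Expectation of the pathwise comparison: Campbell's formula evaluates the main term
  exactly, and the tail moment of the count bounds the error by a multiple of the squared intensity
  of \<open>B\<close>.\<close>

lemma moment_estimate:
  fixes f :: "real ^ 'd \<Rightarrow> complex"
  assumes f[measurable]: "f \<in> borel_measurable borel"
    and B[measurable]: "B \<in> sets borel" and fin: "emeasure (intensity_measure lam) B < \<infinity>"
    and L: "1 \<le> L" "measure (intensity_measure lam) B \<le> L"
    and p: "0 < p" "p \<le> real q"
    and charge: "integrable M (\<lambda>\<omega>. \<bar>A 0 \<omega>\<bar> powr p)"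
    and supp: "\<And>u. u \<notin> B \<Longrightarrow> f (t - u) = 0" and bound: "\<And>u. norm (f (t - u)) \<le> W"
  defines "c \<equiv> \<integral>\<omega>. \<bar>A 0 \<omega>\<bar> powr p \<partial>M"
  shows "\<bar>(\<integral>\<omega>. norm (process_conv f x A t \<omega>) powr p \<partial>M)
      - c * (\<integral>u. norm (f (t - u)) powr p * lam u \<partial>lborel)\<bar>
    \<le> c * W powr p * ((measure (intensity_measure lam) B)\<^sup>2 * fact (Suc q) * exp (exp 1 * L))"
proof -
  define N where "N = point_count x B"
  define \<psi> where "\<psi> \<omega> = (if 2 \<le> N \<omega> then N \<omega> ^ q else 0)" for \<omega>
  define S where "S \<omega> = ennreal (norm (process_conv f x A t \<omega>) powr p)" for \<omega>
  define h where "h u = ennreal (norm (f (t - u)) powr p)" for u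
  define D where "D \<omega> = (\<Sum>j. ennreal (\<bar>A j \<omega>\<bar> powr p) * h (x j \<omega>))" for \<omega>
  define E where "E \<omega> = (\<Sum>j. ennreal (\<bar>A j \<omega>\<bar> powr p) *
    (ennreal (W powr p) * \<psi> \<omega> * indicator B (x j \<omega>)))" for \<omega>
  define K where "K = (measure (intensity_measure lam) B)\<^sup>2 * fact (Suc q) * exp (exp 1 * L)"
  define I where "I = (\<integral>u. norm (f (t - u)) powr p * lam u \<partial>lborel)"
  have K0: "0 \<le> K" by (simp add: K_def)
  have c0: "0 \<le> c" by (simp add: c_def)
  have c: "(\<integral>\<^sup>+\<omega>. ennreal (\<bar>A 0 \<omega>\<bar> powr p) \<partial>M) = ennreal c"
    unfolding c_def by (intro nn_integral_eq_integral charge) auto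
  have [measurable]: "N \<in> borel_measurable M" "\<psi> \<in> borel_measurable M" "h \<in> borel_measurable borel"
    unfolding N_def \<psi>_def[abs_def] h_def[abs_def] by measurable
  have [measurable]: "lam \<in> borel_measurable borel" by (rule intensity_measurable)
  have Smeas[measurable]: "(\<lambda>\<omega>. norm (process_conv f x A t \<omega>) powr p) \<in> borel_measurable M"
    unfolding process_conv_def[abs_def] by measurable
  have [measurable]: "S \<in> borel_measurable M" "D \<in> borel_measurable M" "E \<in> borel_measurable M"
    unfolding S_def[abs_def] D_def[abs_def] E_def[abs_def] by measurable
  have ae: "AE \<omega> in M. S \<omega> \<le> D \<omega> + E \<omega> \<and> D \<omega> \<le> S \<omega> + E \<omega>"
    using AE_point_count_finite[OF B fin]
  proof eventually_elim
    case (elim \<omega>)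
    then obtain n where n: "point_count x B \<omega> = of_nat n" by auto
    from process_conv_powr_estimate[OF n p, of f t W A] supp bound show ?case
      unfolding S_def D_def E_def h_def \<psi>_def N_def by auto
  qed
  have le1: "(\<integral>\<^sup>+\<omega>. S \<omega> \<partial>M) \<le> (\<integral>\<^sup>+\<omega>. D \<omega> \<partial>M) + (\<integral>\<^sup>+\<omega>. E \<omega> \<partial>M)"
    using ae by (subst nn_integral_add[symmetric]) (auto intro!: nn_integral_mono_AE)
  have le2: "(\<integral>\<^sup>+\<omega>. D \<omega> \<partial>M) \<le> (\<integral>\<^sup>+\<omega>. S \<omega> \<partial>M) + (\<integral>\<^sup>+\<omega>. E \<omega> \<partial>M)"
    using ae by (subst nn_integral_add[symmetric]) (auto intro!: nn_integral_mono_AE)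
  have xP[measurable]: "x j \<in> borel_measurable points_algebra" for j by (rule points_algebra_measurable)
  \<comment> \<open>The truncated power of the count is a function of the points alone, so the
    charges can be split off in \<open>E\<close> just as in \<open>D\<close>.\<close>
  have [measurable]: "\<psi> \<in> borel_measurable points_algebra"
    unfolding \<psi>_def[abs_def] N_def point_count_def[abs_def] by measurable
  have hI: "(\<integral>\<^sup>+u. h u \<partial>intensity_measure lam) = (\<integral>\<^sup>+u. ennreal (norm (f (t - u)) powr p * lam u) \<partial>lborel)"
    unfolding intensity_measure_def
    by (simp add: nn_integral_density h_def ennreal_mult intensity_nonneg mult.commute)
  have "(\<integral>\<^sup>+u. h u \<partial>intensity_measure lam) \<le> (\<integral>\<^sup>+u. ennreal (W powr p) * indicator B u \<partial>intensity_measure lam)"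
  proof (intro nn_integral_mono)
    fix u show "h u \<le> ennreal (W powr p) * indicator B u"
      using supp[of u] bound[of u] p by (auto simp: h_def indicator_def intro!: ennreal_leI powr_mono2)
  qed
  also have "\<dots> < \<infinity>" using fin by (simp add: nn_integral_cmult ennreal_mult_less_top)
  finally have hfin: "(\<integral>\<^sup>+u. h u \<partial>intensity_measure lam) < \<infinity>" .
  have I: "I = enn2real (\<integral>\<^sup>+u. h u \<partial>intensity_measure lam)"
    unfolding I_def hI by (intro integral_eq_nn_integral) (auto simp: intensity_nonneg)
  have "(\<integral>\<^sup>+\<omega>. D \<omega> \<partial>M) = ennreal c * (\<integral>\<^sup>+\<omega>. (\<Sum>j. h (x j \<omega>)) \<partial>M)"
    unfolding D_def c[symmetric] by (intro nn_integral_charges_points) auto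
  also have "(\<integral>\<^sup>+\<omega>. (\<Sum>j. h (x j \<omega>)) \<partial>M) = (\<integral>\<^sup>+u. h u \<partial>intensity_measure lam)"
    using p supp by (intro nn_integral_campbell[OF _ B fin]) (auto simp: h_def)
  finally have D: "(\<integral>\<^sup>+\<omega>. D \<omega> \<partial>M) = ennreal c * (\<integral>\<^sup>+u. h u \<partial>intensity_measure lam)" .
  have "(\<integral>\<^sup>+\<omega>. E \<omega> \<partial>M)
      = ennreal c * (\<integral>\<^sup>+\<omega>. (\<Sum>j. ennreal (W powr p) * \<psi> \<omega> * indicator B (x j \<omega>)) \<partial>M)"
    unfolding E_def c[symmetric] by (intro nn_integral_charges_points) auto
  \<comment> \<open>Summing the indicators over \<open>j\<close> produces one more factor
    \<open>N\<close>, which raises the exponent from \<open>q\<close> to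
    \<open>Suc q\<close>.\<close>
  also have "(\<integral>\<^sup>+\<omega>. (\<Sum>j. ennreal (W powr p) * \<psi> \<omega> * indicator B (x j \<omega>)) \<partial>M)
      = ennreal (W powr p) * (\<integral>\<^sup>+\<omega>. (if 2 \<le> N \<omega> then N \<omega> ^ Suc q else 0) \<partial>M)"
    by (subst nn_integral_cmult[symmetric])
       (auto intro!: nn_integral_cong simp: \<psi>_def N_def point_count_def mult_ac)
  also have "\<dots> \<le> ennreal (W powr p) * ennreal K"
    unfolding N_def K_def by (intro mult_left_mono nn_integral_point_count_tail B fin L) auto
  finally have E: "(\<integral>\<^sup>+\<omega>. E \<omega> \<partial>M) \<le> ennreal (c * W powr p * K)"
    using c0 K0 by (simp add: ennreal_mult mult_left_mono mult.assoc)
  \<comment> \<open>\<open>enn2real\<close> sends infinity to 0; this case is ruled out because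
    \<open>hfin\<close> makes the mean of \<open>D\<close> finite and \<open>le1\<close> carries
    finiteness over to \<open>S\<close>.\<close>
  have "\<bar>enn2real (\<integral>\<^sup>+\<omega>. S \<omega> \<partial>M) - enn2real (\<integral>\<^sup>+\<omega>. D \<omega> \<partial>M)\<bar> \<le> c * W powr p * K"
  proof (rule abs_enn2real_diff_le)
    show "(\<integral>\<^sup>+\<omega>. S \<omega> \<partial>M) \<le> (\<integral>\<^sup>+\<omega>. D \<omega> \<partial>M) + ennreal (c * W powr p * K)"
      using le1 E by (meson add_left_mono order_trans)
    show "(\<integral>\<^sup>+\<omega>. D \<omega> \<partial>M) \<le> (\<integral>\<^sup>+\<omega>. S \<omega> \<partial>M) + ennreal (c * W powr p * K)"
      using le2 E by (meson add_left_mono order_trans)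
    show "(\<integral>\<^sup>+\<omega>. D \<omega> \<partial>M) < \<infinity>" using hfin by (simp add: D ennreal_mult_less_top)
  qed (use c0 K0 in auto)
  moreover have "enn2real (\<integral>\<^sup>+\<omega>. D \<omega> \<partial>M) = c * I"
    using c0 by (simp add: D I enn2real_mult)
  moreover have "enn2real (\<integral>\<^sup>+\<omega>. S \<omega> \<partial>M) = (\<integral>\<omega>. norm (process_conv f x A t \<omega>) powr p \<partial>M)"
    unfolding S_def by (intro integral_eq_nn_integral[symmetric]) auto
  ultimately show ?thesis by (simp add: K_def I_def)
qed

end

section \<open>Rescaling\<close>

text \<open>The filter sees \<open>t - u\<close>, so the substitution combines scaling with
  reflection; the absolute Jacobian of the factor \<open>- s\<close> is the stated power of
  \<open>s\<close>.\<close>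

lemma lborel_reflect_scale:
  fixes t :: "'a::euclidean_space"
  assumes "0 < s"
  shows "density (distr lborel borel (\<lambda>v. t - s *\<^sub>R v)) (\<lambda>_. ennreal (s ^ DIM('a))) = lborel"
  using lborel_affine[of "- s" t] assms by simp

lemma lborel_nn_integral_reflect_scale:
  fixes t :: "'a::euclidean_space" and g :: "'a \<Rightarrow> ennreal"
  assumes [measurable]: "g \<in> borel_measurable borel" and s: "0 < s"
  shows "(\<integral>\<^sup>+u. g u \<partial>lborel) = ennreal (s ^ DIM('a)) * (\<integral>\<^sup>+v. g (t - s *\<^sub>R v) \<partial>lborel)"
  by (subst lborel_reflect_scale[OF s, of t, symmetric])
     (simp add: nn_integral_density nn_integral_distr nn_integral_cmult)

lemma lborel_integral_reflect_scale:
  fixes t :: "'a::euclidean_space" and g :: "'a \<Rightarrow> real"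
  assumes [measurable]: "g \<in> borel_measurable borel" and s: "0 < s"
  shows "(\<integral>u. g u \<partial>lborel) = s ^ DIM('a) * (\<integral>v. g (t - s *\<^sub>R v) \<partial>lborel)"
  by (subst lborel_reflect_scale[OF s, of t, symmetric])
     (use s in \<open>simp add: integral_density integral_distr\<close>)

lemma cube_eq_cbox: "cube T = cbox 0 (\<chi> i. T)"
  by (auto simp: cube_def mem_box_cart)
lemma emeasure_cube_finite: "emeasure lborel (cube T) < \<infinity>"
  unfolding cube_eq_cbox by (rule emeasure_lborel_cbox_finite)

lemma cube_borel [measurable]: "cube T \<in> sets borel"
  unfolding cube_eq_cbox by simp

text \<open>The modulation has modulus one; this makes all later bounds uniform in the
  frequency.\<close>

lemma norm_gabor_filter: "norm (gabor_filter w (s, \<xi>) t) = norm (w (t /\<^sub>R s))"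
  by (simp add: gabor_filter_def norm_mult)

lemma gabor_filter_measurable [measurable]:
  assumes [measurable]: "w \<in> borel_measurable borel"
  shows "gabor_filter w \<gamma> \<in> borel_measurable borel"
  unfolding gabor_filter_def[abs_def] by (cases \<gamma>) simp

context compound_poisson_process
begin

text \<open>Joint measurability in place and outcome passes to the parameter integral. It is needed
  when the moment is averaged over the period cube.\<close>

lemma scattering_moment_measurable:
  fixes w :: "real ^ 'd \<Rightarrow> complex"
  assumes [measurable]: "w \<in> borel_measurable borel"
  shows "scattering_moment M x A w \<gamma> p \<in> borel_measurable borel"
proof -
  have "(\<lambda>(t, \<omega>). norm (process_conv (gabor_filter w \<gamma>) x A t \<omega>) powr p)
      \<in> borel_measurable (borel \<Otimes>\<^sub>M M)"
    unfolding process_conv_def[abs_def] by measurable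
  from borel_measurable_lebesgue_integral[OF this]
  show ?thesis by (simp add: scattering_moment_def[abs_def])
qed

text \<open>The visible set has intensity of order \<open>s ^ CARD('d)\<close>, so the squared error
  term, divided once by this power, still tends to zero. The cap \<open>R\<close> on the scales
  allows one constant for all scales, frequencies and places.\<close>

lemma scattering_moment_estimate:
  fixes w :: "real ^ 'd \<Rightarrow> complex"
  assumes w[measurable]: "w \<in> borel_measurable borel"
    and supp: "\<And>v. v \<notin> cube 1 \<Longrightarrow> w v = 0" and bound: "\<And>v. norm (w v) \<le> W"
    and lam: "\<And>u. lam u \<le> \<Lambda>"
    and p: "0 < p" and charge: "integrable M (\<lambda>\<omega>. \<bar>A 0 \<omega>\<bar> powr p)"
  obtains K where "\<And>s \<xi> t. 0 < s \<Longrightarrow> s \<le> R \<Longrightarrow>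
    \<bar>scattering_moment M x A w (s, \<xi>) p t / s ^ CARD('d)
      - (\<integral>\<omega>. \<bar>A 0 \<omega>\<bar> powr p \<partial>M) * (\<integral>v. norm (w v) powr p * lam (t - s *\<^sub>R v) \<partial>lborel)\<bar>
    \<le> K * s ^ CARD('d)"
proof -
  define c where "c = (\<integral>\<omega>. \<bar>A 0 \<omega>\<bar> powr p \<partial>M)"
  have c0: "0 \<le> c" by (simp add: c_def)
  define V where "V = measure lborel (cube 1 :: (real ^ 'd) set)"
  define q where "q = nat \<lceil>p\<rceil>"
  have q: "p \<le> real q" by (simp add: q_def real_nat_ceiling_ge)
  have \<Lambda>0: "0 \<le> \<Lambda>" using lam[of 0] intensity_nonneg[of 0] by linarith
  \<comment> \<open>Bounds the intensity of the visible set at every scale up to \<open>R\<close>;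
    the maximum with 1 meets the requirement of the tail estimate.\<close>
  define L where "L = max 1 (\<Lambda> * V * R ^ CARD('d))"
  define F where "F = fact (Suc q) * exp (exp 1 * L)"
  have F0: "0 \<le> F" by (simp add: F_def)
  have [measurable]: "lam \<in> borel_measurable borel" by (rule intensity_measurable)
  have V0: "0 \<le> V" by (simp add: V_def)
  have V: "emeasure lborel (cube 1 :: (real ^ 'd) set) = ennreal V"
    unfolding V_def using emeasure_cube_finite by (intro emeasure_eq_ennreal_measure) (simp add: less_top)
  show thesis
  proof (rule that[of "c * W powr p * ((\<Lambda> * V)\<^sup>2 * F)"])
    fix s :: real and \<xi> t :: "real ^ 'd" assume s: "0 < s" "s \<le> R"
    define f where "f = gabor_filter w (s, \<xi>)"
    \<comment> \<open>The points visible to the filter at \<open>t\<close>: a reflected unit cube,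
      scaled by \<open>s\<close> and translated by \<open>t\<close>.\<close>
    define B where "B = {u. (t - u) /\<^sub>R s \<in> cube 1}"
    define m where "m = measure (intensity_measure lam) B"
    have [measurable]: "f \<in> borel_measurable borel" unfolding f_def by measurable
    have B[measurable]: "B \<in> sets borel"
      unfolding B_def by measurable
    have "emeasure (intensity_measure lam) B = (\<integral>\<^sup>+u. ennreal (lam u) * indicator B u \<partial>lborel)"
      unfolding intensity_measure_def by (simp add: emeasure_density)
    also have "\<dots> \<le> (\<integral>\<^sup>+u. ennreal \<Lambda> * indicator B u \<partial>lborel)"
      using lam by (intro nn_integral_mono mult_right_mono ennreal_leI) auto
    also have "\<dots> = ennreal \<Lambda> * (\<integral>\<^sup>+u. indicator B u \<partial>lborel)"
      by (intro nn_integral_cmult) auto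
    also have "(\<integral>\<^sup>+u. indicator B u \<partial>lborel)
        = ennreal (s ^ CARD('d)) * (\<integral>\<^sup>+v. indicator B (t - s *\<^sub>R v) \<partial>lborel)"
      using lborel_nn_integral_reflect_scale[of "indicator B" s t] s by simp
    also have "(\<lambda>v. indicator B (t - s *\<^sub>R v) :: ennreal) = indicator (cube 1)"
      using s by (auto simp: B_def indicator_def fun_eq_iff)
    also have "ennreal \<Lambda> * (ennreal (s ^ CARD('d)) * (\<integral>\<^sup>+v. indicator (cube 1 :: (real ^ 'd) set) v \<partial>lborel))
        = ennreal (\<Lambda> * V * s ^ CARD('d))"
      using s \<Lambda>0 V0 by (simp add: V ennreal_mult mult_ac)
    finally have le: "emeasure (intensity_measure lam) B \<le> ennreal (\<Lambda> * V * s ^ CARD('d))" .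
    then have fin: "emeasure (intensity_measure lam) B < \<infinity>"
      by (rule le_less_trans) simp
    have m: "m \<le> \<Lambda> * V * s ^ CARD('d)"
      unfolding m_def measure_def using le s \<Lambda>0 by (intro enn2real_leI) (auto simp: V_def)
    also have "\<dots> \<le> \<Lambda> * V * R ^ CARD('d)"
      using s \<Lambda>0 by (intro mult_left_mono power_mono) (auto simp: V_def)
    finally have mL: "m \<le> L" by (simp add: L_def)
    \<comment> \<open>One power of \<open>s ^ CARD('d)\<close> is cancelled by the normalisation;
      the other one is the rate of the error.\<close>
    have m2: "m\<^sup>2 \<le> (\<Lambda> * V)\<^sup>2 * s ^ CARD('d) * s ^ CARD('d)"
      using power_mono[OF m, of 2] by (simp add: m_def power2_eq_square mult_ac)
    have "\<bar>scattering_moment M x A w (s, \<xi>) p t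
        - c * (\<integral>u. norm (f (t - u)) powr p * lam u \<partial>lborel)\<bar>
      \<le> c * W powr p * (m\<^sup>2 * fact (Suc q) * exp (exp 1 * L))"
      unfolding scattering_moment_def f_def[symmetric] c_def m_def
    proof (rule moment_estimate[OF _ B fin _ _ p q charge])
      show "f (t - u) = 0" if "u \<notin> B" for u
        using supp[of "(t - u) /\<^sub>R s"] that by (simp add: f_def B_def gabor_filter_def)
      show "norm (f (t - u)) \<le> W" for u
        unfolding f_def norm_gabor_filter by (rule bound)
    qed (use mL in \<open>auto simp: L_def m_def\<close>)
    \<comment> \<open>After substitution the kernel no longer depends on the scale; only the
      argument of \<open>lam\<close> does.\<close>
    also have "(\<integral>u. norm (f (t - u)) powr p * lam u \<partial>lborel)
        = s ^ CARD('d) * (\<integral>v. norm (w v) powr p * lam (t - s *\<^sub>R v) \<partial>lborel)"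
      using s by (subst lborel_integral_reflect_scale[where t = t and s = s])
        (simp_all add: f_def norm_gabor_filter)
    also have "c * W powr p * (m\<^sup>2 * fact (Suc q) * exp (exp 1 * L))
        \<le> c * W powr p * (((\<Lambda> * V)\<^sup>2 * s ^ CARD('d) * s ^ CARD('d)) * F)"
      using m2 F0 c0 unfolding F_def by (simp only: mult.assoc[of _ "fact (Suc q)"]) (intro mult_left_mono mult_right_mono, auto)
    finally have *: "\<bar>scattering_moment M x A w (s, \<xi>) p t
        - c * (s ^ CARD('d) * (\<integral>v. norm (w v) powr p * lam (t - s *\<^sub>R v) \<partial>lborel))\<bar>
      \<le> c * W powr p * (((\<Lambda> * V)\<^sup>2 * s ^ CARD('d) * s ^ CARD('d)) * F)" .
    have sd: "0 < s ^ CARD('d)" using s by simp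
    let ?S = "scattering_moment M x A w (s, \<xi>) p t"
    let ?J = "\<integral>v. norm (w v) powr p * lam (t - s *\<^sub>R v) \<partial>lborel"
    have "?S / s ^ CARD('d) - c * ?J = (?S - c * (s ^ CARD('d) * ?J)) / s ^ CARD('d)"
      using sd s(1) by (simp add: diff_divide_distrib)
    then have "\<bar>?S / s ^ CARD('d) - c * ?J\<bar> = \<bar>?S - c * (s ^ CARD('d) * ?J)\<bar> / s ^ CARD('d)"
      using s(1) by (simp only: abs_divide) simp
    also have "\<dots> \<le> c * W powr p * ((\<Lambda> * V)\<^sup>2 * F) * s ^ CARD('d)"
      using * sd by (simp add: pos_divide_le_eq mult_ac)
    finally show "\<bar>scattering_moment M x A w (s, \<xi>) p t / s ^ CARD('d)
        - (\<integral>\<omega>. \<bar>A 0 \<omega>\<bar> powr p \<partial>M) * (\<integral>v. norm (w v) powr p * lam (t - s *\<^sub>R v) \<partial>lborel)\<bar>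
      \<le> c * W powr p * ((\<Lambda> * V)\<^sup>2 * F) * s ^ CARD('d)" by (simp add: c_def)
  qed
qed

end

section \<open>The limit of vanishing scale\<close>

lemma Lp_norm_powr: "0 < p \<Longrightarrow> Lp_norm p f powr p = (\<integral>t. norm (f t) powr p \<partial>lborel)"
  by (simp add: Lp_norm_def powr_powr)

text \<open>The image of the compact cube is bounded, and outside it the function is zero.\<close>

lemma bounded_of_continuous_support:
  fixes w :: "real ^ 'd \<Rightarrow> complex"
  assumes "continuous_on UNIV w" and supp: "\<And>v. v \<notin> cube T \<Longrightarrow> w v = 0"
  obtains W where "\<And>v. norm (w v) \<le> W" "0 \<le> W"
proof -
  have "compact (w ` cube T)"
    using assms(1) unfolding cube_eq_cbox
    by (intro compact_continuous_image compact_cbox) (rule continuous_on_subset, auto)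
  then obtain W where W: "\<And>v. v \<in> cube T \<Longrightarrow> norm (w v) \<le> W"
    using compact_imp_bounded by (fastforce simp: bounded_iff)
  show thesis
  proof (rule that[of "max 0 W"])
    fix v show "norm (w v) \<le> max 0 W"
      using W[of v] supp[of v] by (cases "v \<in> cube T") auto
  qed simp
qed

theorem theorem2:
  fixes M :: "'w measure"
    and lam :: "real ^ 'd \<Rightarrow> real"
    and x :: "nat \<Rightarrow> 'w \<Rightarrow> real ^ 'd"
    and A :: "nat \<Rightarrow> 'w \<Rightarrow> real"
    and w :: "real ^ 'd \<Rightarrow> complex"
    and s :: "nat \<Rightarrow> real"
    and \<xi> :: "nat \<Rightarrow> real ^ 'd"
    and p T :: real
  assumes w_continuous: "continuous_on UNIV w"
    and w_L2: "integrable lborel (\<lambda>t. (norm (w t))\<^sup>2)"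
    and w_support: "closure {t. w t \<noteq> 0} \<subseteq> cube 1"
    and T_pos: "0 < T"
    and lam_periodic: "coord_periodic T lam"
    and lam_continuous: "continuous_on UNIV lam"
    and lam_min: "0 < (INF t. lam t)"
    and lam_bounded: "bounded (range lam)"
    and process: "compound_poisson_process M lam x A"
    and p_ge_1: "1 \<le> p"
    and charge_moment: "integrable M (\<lambda>\<omega>. \<bar>A 0 \<omega>\<bar> powr p)"
    and s_pos: "\<And>k. 0 < s k"
    and s_lim: "s \<longlonglongrightarrow> 0"
  shows "(\<forall>t. (\<lambda>k. scattering_moment M x A w (s k, \<xi> k) p t / s k ^ CARD('d))
            \<longlonglongrightarrow> lam t * (\<integral>\<omega>. \<bar>A 0 \<omega>\<bar> powr p \<partial>M) * Lp_norm p w powr p) \<and>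
         (\<lambda>k. invariant_scattering_moment T M x A w (s k, \<xi> k) p / s k ^ CARD('d))
            \<longlonglongrightarrow> cube_mean T lam * (\<integral>\<omega>. \<bar>A 0 \<omega>\<bar> powr p \<partial>M) * Lp_norm p w powr p"
proof -
  interpret compound_poisson_process M lam x A by (rule process)
  define c where "c = (\<integral>\<omega>. \<bar>A 0 \<omega>\<bar> powr p \<partial>M)"
  define I where "I = (\<integral>v. norm (w v) powr p \<partial>lborel)"
  have c0: "0 \<le> c" by (simp add: c_def)
  have p: "0 < p" using p_ge_1 by simp
  have I: "Lp_norm p w powr p = I" using p by (simp add: I_def Lp_norm_powr)
  have [measurable]: "w \<in> borel_measurable borel"
    using w_continuous by (rule borel_measurable_continuous_onI)
  have [measurable]: "lam \<in> borel_measurable borel" by (rule intensity_measurable)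
  have supp: "w v = 0" if "v \<notin> cube 1" for v
    using w_support closure_subset[of "{t. w t \<noteq> 0}"] that by auto
  obtain W where W: "\<And>v. norm (w v) \<le> W" "0 \<le> W"
    using bounded_of_continuous_support[OF w_continuous supp] by blast
  obtain \<Lambda> where \<Lambda>: "\<And>u. \<bar>lam u\<bar> \<le> \<Lambda>"
    using lam_bounded by (auto simp: bounded_iff)
  obtain R where R: "\<And>k. s k \<le> R"
    using convergent_imp_Bseq[of s] s_lim by (auto simp: convergent_def Bseq_def abs_le_iff)
  have lam_le: "lam u \<le> \<Lambda>" for u using \<Lambda>[of u] by simp
  have \<Lambda>0: "0 \<le> \<Lambda>" using \<Lambda>[of 0] by linarith
  obtain K where K: "\<bar>scattering_moment M x A w (s, \<xi>) p t / s ^ CARD('d)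
      - c * (\<integral>v. norm (w v) powr p * lam (t - s *\<^sub>R v) \<partial>lborel)\<bar> \<le> K * s ^ CARD('d)"
    if "0 < s" "s \<le> R" for s \<xi> t
    using scattering_moment_estimate[of w W \<Lambda> p R, OF _ supp W(1) lam_le p charge_moment] unfolding c_def by auto
  \<comment> \<open>Boundedness and compact support give integrability of this power for the given
    \<open>p\<close>.\<close>
  have int_w: "integrable lborel (\<lambda>v. norm (w v) powr p)"
  proof (rule Bochner_Integration.integrable_bound)
    show "integrable lborel (\<lambda>v. W powr p * indicator (cube 1 :: (real ^ 'd) set) v)"
      using emeasure_cube_finite by (intro integrable_mult_right integrable_real_indicator) auto
    show "AE v in lborel. norm (norm (w v) powr p) \<le> norm (W powr p * indicator (cube 1) v)"
      using W supp p by (auto intro!: always_eventually powr_mono2 simp: indicator_def)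
  qed measurable
  define J where "J k t = (\<integral>v. norm (w v) powr p * lam (t - s k *\<^sub>R v) \<partial>lborel)" for k t
  define Q where "Q k t = scattering_moment M x A w (s k, \<xi> k) p t / s k ^ CARD('d)" for k t
  have QJ: "\<bar>Q k t - c * J k t\<bar> \<le> K * s k ^ CARD('d)" for k t
    unfolding Q_def J_def using K s_pos R by blast
  \<comment> \<open>Continuity of \<open>lam\<close> gives the pointwise limit of the integrand;
    boundedness of \<open>lam\<close> gives the majorant.\<close>
  have J_lim: "(\<lambda>k. J k t) \<longlonglongrightarrow> lam t * I" for t
  proof -
    have "(\<lambda>k. J k t) \<longlonglongrightarrow> (\<integral>v. norm (w v) powr p * lam t \<partial>lborel)"
      unfolding J_def
    proof (rule integral_dominated_convergence[where w = "\<lambda>v. norm (w v) powr p * \<Lambda>"])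
      show "AE v in lborel. (\<lambda>k. norm (w v) powr p * lam (t - s k *\<^sub>R v)) \<longlonglongrightarrow> norm (w v) powr p * lam t"
      proof (intro always_eventually allI tendsto_mult tendsto_const)
        fix v
        have "(\<lambda>k. t - s k *\<^sub>R v) \<longlonglongrightarrow> t - 0 *\<^sub>R v"
          by (intro tendsto_intros s_lim)
        moreover have "isCont lam t"
          using lam_continuous by (simp add: continuous_on_eq_continuous_at)
        ultimately show "(\<lambda>k. lam (t - s k *\<^sub>R v)) \<longlonglongrightarrow> lam t"
          by (intro isCont_tendsto_compose[of t lam]) auto
      qed
      show "AE v in lborel. norm (norm (w v) powr p * lam (t - s k *\<^sub>R v)) \<le> norm (w v) powr p * \<Lambda>" for k
        using \<Lambda> by (auto simp: abs_mult intro!: always_eventually mult_left_mono)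
    qed (use int_w in auto)
    then show ?thesis by (simp add: I_def mult.commute)
  qed
  \<comment> \<open>The exponent is at least one because the coordinate type is nonempty.\<close>
  have err_lim: "(\<lambda>k. K * s k ^ CARD('d)) \<longlonglongrightarrow> 0"
    using tendsto_mult[OF tendsto_const tendsto_power[OF s_lim, of "CARD('d)"], of K]
    by (simp add: zero_power)
  have Q_lim: "(\<lambda>k. Q k t) \<longlonglongrightarrow> lam t * c * I" for t
  proof -
    have "(\<lambda>k. Q k t - c * J k t) \<longlonglongrightarrow> 0"
      using QJ by (intro Lim_null_comparison[OF _ err_lim] always_eventually) auto
    from tendsto_add[OF this tendsto_mult[OF tendsto_const J_lim[of t], of c]]
    show ?thesis by (simp add: mult_ac)
  qed
  have J_bound: "\<bar>J k t\<bar> \<le> \<Lambda> * I" for k t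
  proof -
    have "norm (J k t) \<le> (\<integral>v. norm (norm (w v) powr p * lam (t - s k *\<^sub>R v)) \<partial>lborel)"
      unfolding J_def by (rule integral_norm_bound)
    also have "\<dots> \<le> (\<integral>v. norm (w v) powr p * \<Lambda> \<partial>lborel)"
      using int_w \<Lambda> \<Lambda>0 by (intro integral_mono') (auto simp: abs_mult intro: mult_left_mono)
    finally have "norm (J k t) \<le> (\<integral>v. norm (w v) powr p * \<Lambda> \<partial>lborel)" .
    then show ?thesis by (simp add: I_def mult.commute)
  qed
  obtain E where E: "\<And>k. K * s k ^ CARD('d) \<le> E"
    using convergent_imp_Bseq[of "\<lambda>k. K * s k ^ CARD('d)"] err_lim
    by (auto simp: convergent_def Bseq_def abs_le_iff)
  \<comment> \<open>A bound uniform in both \<open>k\<close> and \<open>t\<close>, hence an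
    integrable majorant on the period cube.\<close>
  have Q_bound: "\<bar>Q k t\<bar> \<le> c * (\<Lambda> * I) + E" for k t
  proof -
    have "\<bar>c * J k t\<bar> \<le> c * (\<Lambda> * I)"
      using mult_left_mono[OF J_bound[of k t] c0] c0 by (simp add: abs_mult)
    then show ?thesis using QJ[of k t] E[of k] by linarith
  qed
  have [measurable]: "Q k \<in> borel_measurable borel" for k
    unfolding Q_def using scattering_moment_measurable[of w "(s k, \<xi> k)" p] by measurable
  \<comment> \<open>A second dominated convergence, now in \<open>t\<close>, transfers the pointwise
    limit to the average.\<close>
  have "(\<lambda>k. LINT t:cube T|lborel. Q k t) \<longlonglongrightarrow> (LINT t:cube T|lborel. lam t * c * I)"
    unfolding set_lebesgue_integral_def
  proof (rule integral_dominated_convergence[where w = "\<lambda>t. indicator (cube T) t * (c * (\<Lambda> * I) + E)"])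
    show "AE t in lborel. (\<lambda>k. indicator (cube T) t *\<^sub>R Q k t) \<longlonglongrightarrow> indicator (cube T) t *\<^sub>R (lam t * c * I)"
      by (intro always_eventually allI tendsto_scaleR tendsto_const Q_lim)
    show "integrable lborel (\<lambda>t. indicator (cube T) t * (c * (\<Lambda> * I) + E) :: real)"
      using emeasure_cube_finite by (intro integrable_mult_left integrable_real_indicator) auto
    show "AE t in lborel. norm (indicator (cube T) t *\<^sub>R Q k t) \<le> indicator (cube T) t * (c * (\<Lambda> * I) + E)" for k
      using Q_bound by (auto simp: indicator_def)
  qed measurable
  then have "(\<lambda>k. cube_mean T (Q k)) \<longlonglongrightarrow> 1 / T ^ CARD('d) * (LINT t:cube T|lborel. lam t * c * I)"
    unfolding cube_mean_def by (intro tendsto_mult tendsto_const)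
  also have "1 / T ^ CARD('d) * (LINT t:cube T|lborel. lam t * c * I) = cube_mean T lam * c * I"
    by (simp add: cube_mean_def)
  \<comment> \<open>The normalising power of \<open>s k\<close> is constant in \<open>t\<close> and
    leaves the average.\<close>
  also have "(\<lambda>k. cube_mean T (Q k))
      = (\<lambda>k. invariant_scattering_moment T M x A w (s k, \<xi> k) p / s k ^ CARD('d))"
    by (simp add: invariant_scattering_moment_def cube_mean_def Q_def[abs_def] fun_eq_iff)
  finally show ?thesis
    using Q_lim by (simp add: Q_def I c_def)
qed

end
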